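(* Let $m\geq 2$ be an integer, and let $\Phi$ and $\Phi_i$, $i=1,\dots,m$, be Young functions. Then the following statements are equivalent: (1) There exists a constant $C>0$ such that $$\prod_{i=1}^m \Phi_i^{-1}(t)\leq C\,\Phi^{-1}(t)\quad\text{for every } t\geq 0.$$ (2) There exists a constant $C>0$ such that for all $t_i\geq 0$, $i=1,\dots,m$, $$\Phi\left(\frac{\prod_{i=1}^m t_i}{C}\right)\leq \sum_{i=1}^m \Phi_i(t_i).$$ (3) There exists a constant $M>0$ such that $$\left\Vert \prod_{i=1}^m f_i\right\Vert_{L_\Phi(\mathbb{R}^n)}\leq M\prod_{i=1}^m \|f_i\|_{L_{\Phi_i}(\mathbb{R}^n)}$$ for every $f_i\in L_{\Phi_i}(\mathbb{R}^n)$, $i=1,\dots,m$. (4) For every $f_i\in L_{\Phi_i}(\mathbb{R}^n)$, $i=1,\dots,m$, one has $\prod_{i=1}^m f_i\in L_\Phi(\mathbb{R}^n)$.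
   Context: A Young function is a function $\Phi:[0,\infty)\to[0,\infty)$ that is convex and left-continuous, with $\Phi(0)=0$ and $\lim_{t\to\infty}\Phi(t)=\infty$. For a Young function $\Phi$ and $s\geq 0$, define $\Phi^{-1}(s):=\inf\{r\geq 0:\Phi(r)>s\}$. For a Young function $\Phi$, the Orlicz space $L_\Phi(\mathbb{R}^n)$ is the set of measurable functions $f:\mathbb{R}^n\to\mathbb{R}$ such that $\int_{\mathbb{R}^n}\Phi(a|f(x)|)\,dx<\infty$ for some $a>0$, equipped with the norm $$\|f\|_{L_\Phi(\mathbb{R}^n)}:=\inf\left\{b>0:\int_{\mathbb{R}^n}\Phi\left(\frac{|f(x)|}{b}\right)dx\leq 1\right\}.$$ *)

theory Defs
  imports "HOL-Analysis.Analysis"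
begin

text \<open>
  Functions on \<open>[0, \<infinity>)\<close> are represented by functions of type \<open>real \<Rightarrow> real\<close>; their values at
  negative arguments are unconstrained, and are never used below.
\<close>

definition young_function :: "(real \<Rightarrow> real) \<Rightarrow> bool" where
  "young_function \<Phi> \<longleftrightarrow>
     (\<forall>t\<ge>0. \<Phi> t \<ge> 0) \<and> convex_on {0..} \<Phi> \<and> (\<forall>t>0. continuous (at_left t) \<Phi>) \<and>
     \<Phi> 0 = 0 \<and> filterlim \<Phi> at_top at_top"

definition young_inverse :: "(real \<Rightarrow> real) \<Rightarrow> real \<Rightarrow> real" where
  "young_inverse \<Phi> s = Inf {r. r \<ge> 0 \<and> \<Phi> r > s}"

definition orlicz_space :: "(real \<Rightarrow> real) \<Rightarrow> (real ^ 'n \<Rightarrow> real) set" where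
  "orlicz_space \<Phi> =
     {f \<in> borel_measurable lebesgue.
        \<exists>a>0. (\<integral>\<^sup>+ x. ennreal (\<Phi> (a * \<bar>f x\<bar>)) \<partial>lebesgue) < \<infinity>}"

text \<open>
  The norm takes values in \<open>[0, \<infinity>]\<close>, with the convention \<open>inf \<emptyset> = \<infinity>\<close>. A norm inequality for
  a function not known to lie in the Orlicz space, with a finite bound, thus includes the claim
  that some admissible \<open>b\<close> exists.
\<close>

definition orlicz_norm :: "(real \<Rightarrow> real) \<Rightarrow> (real ^ 'n \<Rightarrow> real) \<Rightarrow> ennreal" where
  "orlicz_norm \<Phi> f =
     (INF b\<in>{b::real. b > 0 \<and> (\<integral>\<^sup>+ x. ennreal (\<Phi> (\<bar>f x\<bar> / b)) \<partial>lebesgue) \<le> 1}. ennreal b)"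

end

theory Submission
  imports Defs
begin

text \<open>Left-continuity makes \<open>young_inverse \<Phi>\<close> the upper adjoint of \<Phi> on
  nonnegative reals (\<open>young_inverse_galois\<close>), so inequalities between inverses and
  inequalities between Young functions translate into each other. For (1) to (2), apply (1) at the
  level s given by the sum of the \<open>\<Phi>s i (t i)\<close>: each \<open>t i\<close> lies below
  the inverse of \<open>\<Phi>s i\<close> at s. For (2) to (1), insert the inverses at t; the sum is
  then at most m t, and convexity absorbs the factor m into the constant.

  Integrating (2) over normalised functions bounds the modular of the product by m, and convexity
  again brings it down to 1, which gives (3) with constant m C (\<open>orlicz_norm_prod_le\<close>).
  Membership in an Orlicz space is the same as measurability with finite norm
  (\<open>orlicz_norm_finite\<close>, \<open>orlicz_space_if_norm_finite\<close>), so (3) gives (4).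

  The cycle closes with (4) to (2) by contraposition (\<open>pointwise_if_orlicz_prod\<close>):
  violations of (2) for a rapidly growing sequence of constants are spread over disjoint sets of
  suitable measure, producing functions in the given spaces whose product is not in the target
  space.\<close>

section \<open>Young functions and their generalised inverses\<close>

lemma young_function_scale:
  assumes "young_function \<Phi>" "0 \<le> c" "c \<le> 1" "0 \<le> x"
  shows "\<Phi> (c * x) \<le> c * \<Phi> x"
proof -
  have "convex_on {0..} \<Phi>" and 0: "\<Phi> 0 = 0"
    using assms by (auto simp: young_function_def)
  from convex_onD[OF this(1), of c 0 x] show ?thesis using assms 0 by simp
qed

lemma young_function_nonneg: "young_function \<Phi> \<Longrightarrow> 0 \<le> x \<Longrightarrow> 0 \<le> \<Phi> x"
  by (auto simp: young_function_def)

text \<open>Monotonicity is a consequence of convexity, nonnegativity and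
  \<open>\<Phi> 0 = 0\<close>: write x as the multiple \<open>x / y\<close> of y and scale.\<close>

lemma young_function_mono:
  assumes "young_function \<Phi>" "0 \<le> x" "x \<le> y"
  shows "\<Phi> x \<le> \<Phi> y"
proof (cases "y = 0")
  case False
  then have "y > 0" using assms by simp
  then have "\<Phi> ((x / y) * y) \<le> (x / y) * \<Phi> y"
    using assms by (intro young_function_scale) auto
  also have "\<dots> \<le> 1 * \<Phi> y"
    using assms \<open>y > 0\<close> by (intro mult_right_mono young_function_nonneg[OF assms(1)]) auto
  finally show ?thesis using \<open>y > 0\<close> by simp
qed (use assms in auto)

text \<open>If \<open>\<Phi> r \<le> s\<close>, monotonicity makes r a lower bound of the set whose
  infimum is taken. Conversely \<Phi> is at most s strictly below the infimum, left-continuity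
  carries this bound to the infimum itself, and monotonicity carries it to every smaller r. Growth
  to infinity makes the set nonempty, so that \<open>Inf\<close> is a genuine infimum.\<close>

lemma young_inverse_galois:
  assumes \<Phi>: "young_function \<Phi>" and "0 \<le> r" "0 \<le> s"
  shows "\<Phi> r \<le> s \<longleftrightarrow> r \<le> young_inverse \<Phi> s"
proof -
  let ?A = "{r. r \<ge> 0 \<and> \<Phi> r > s}"
  have ne: "?A \<noteq> {}"
  proof -
    have "filterlim \<Phi> at_top at_top" using \<Phi> by (auto simp: young_function_def)
    then have "eventually (\<lambda>r. \<Phi> r > s \<and> r \<ge> 0) at_top"
      by (intro eventually_conj eventually_ge_at_top) (simp add: filterlim_at_top_dense)
    then show ?thesis by (auto dest: eventually_happens)
  qed
  have lower: "q \<le> young_inverse \<Phi> s" if "\<Phi> q \<le> s" for q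
    unfolding young_inverse_def
  proof (rule cInf_greatest[OF ne])
    fix y assume "y \<in> ?A"
    then show "q \<le> y"
      using young_function_mono[OF \<Phi>, of y q] that by fastforce
  qed
  have nonneg: "0 \<le> young_inverse \<Phi> s"
    using \<Phi> \<open>0 \<le> s\<close> by (intro lower) (simp add: young_function_def)
  have "\<Phi> (young_inverse \<Phi> s) \<le> s"
  \<comment> \<open>Left-continuity is available only at positive points; at 0 the bound is
    \<open>\<Phi> 0 = 0\<close>.\<close>
  proof (cases "young_inverse \<Phi> s = 0")
    case True
    then show ?thesis using \<Phi> \<open>0 \<le> s\<close> by (simp add: young_function_def)
  next
    case False
    let ?t = "young_inverse \<Phi> s"
    have "?t > 0" using False nonneg by simp
    then have lim: "(\<Phi> \<longlongrightarrow> \<Phi> ?t) (at_left ?t)"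
      using \<Phi> by (auto simp: young_function_def continuous_within)
    have le: "\<Phi> y \<le> s" if "0 < y" "y < ?t" for y
    proof (rule ccontr)
      assume "\<not> \<Phi> y \<le> s"
      then have "Inf ?A \<le> y" using that by (intro cInf_lower bdd_belowI[of _ 0]) auto
      then show False using that by (simp add: young_inverse_def)
    qed
    have "eventually (\<lambda>y. \<Phi> y \<le> s) (at_left ?t)"
      using eventually_at_left_real[OF \<open>?t > 0\<close>] by eventually_elim (use le in auto)
    then show ?thesis by (intro tendsto_upperbound[OF lim]) auto
  qed
  then show ?thesis
    using lower young_function_mono[OF \<Phi> \<open>0 \<le> r\<close>] order_trans by blast
qed

lemma young_inverse_nonneg: "young_function \<Phi> \<Longrightarrow> 0 \<le> s \<Longrightarrow> 0 \<le> young_inverse \<Phi> s"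
  using young_inverse_galois[of \<Phi> 0 s] by (simp add: young_function_def)

section \<open>Modulars, and membership in terms of the norm\<close>

text \<open>The values of \<Phi> at negative arguments are arbitrary, so \<Phi> is first replaced by
  its constant extension to the left of 0, which is monotone on the whole line and hence
  Borel.\<close>

lemma young_function_measurable:
  assumes "young_function \<Phi>" and [measurable]: "f \<in> borel_measurable M"
    and nn: "\<And>x. 0 \<le> f x"
  shows "(\<lambda>x. \<Phi> (f x)) \<in> borel_measurable M"
proof -
  have "mono (\<lambda>x. \<Phi> (max 0 x))"
    by (intro monoI young_function_mono[OF assms(1)]) auto
  then have [measurable]: "(\<lambda>x. \<Phi> (max 0 x)) \<in> borel_measurable borel"
    by (rule borel_measurable_mono)
  have "(\<lambda>x. \<Phi> (max 0 (f x))) \<in> borel_measurable M" by measurable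
  then show ?thesis using nn by (simp add: max_absorb2)
qed

lemma young_integral_scale:
  assumes "young_function \<Phi>" "f \<in> borel_measurable M" "\<And>x. 0 \<le> f x" "0 \<le> c" "c \<le> 1"
  shows "(\<integral>\<^sup>+x. ennreal (\<Phi> (c * f x)) \<partial>M) \<le> ennreal c * (\<integral>\<^sup>+x. ennreal (\<Phi> (f x)) \<partial>M)"
proof -
  have "(\<integral>\<^sup>+x. ennreal (\<Phi> (c * f x)) \<partial>M) \<le> (\<integral>\<^sup>+x. ennreal c * ennreal (\<Phi> (f x)) \<partial>M)"
    using assms young_function_scale[OF assms(1)] young_function_nonneg[OF assms(1)]
    by (intro nn_integral_mono) (auto simp flip: ennreal_mult intro!: ennreal_leI)
  also have "\<dots> = ennreal c * (\<integral>\<^sup>+x. ennreal (\<Phi> (f x)) \<partial>M)"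
    by (intro nn_integral_cmult measurable_compose[OF _ measurable_ennreal]
        young_function_measurable[OF assms(1)] assms)
  finally show ?thesis .
qed

text \<open>If the modular of \<open>a * \<bar>f x\<bar>\<close> is at most k, scaling the argument
  by \<open>1 / k\<close> makes it at most 1, so \<open>k / a\<close> is admissible in the
  norm.\<close>

lemma orlicz_norm_finite:
  assumes \<Phi>: "young_function \<Phi>" and f: "f \<in> orlicz_space \<Phi>"
  shows "orlicz_norm \<Phi> f < \<infinity>"
proof -
  from f obtain a where a: "a > 0" "(\<integral>\<^sup>+x. ennreal (\<Phi> (a * \<bar>f x\<bar>)) \<partial>lebesgue) < \<infinity>"
    and [measurable]: "f \<in> borel_measurable lebesgue"
    by (auto simp: orlicz_space_def)
  define I where "I = (\<integral>\<^sup>+x. ennreal (\<Phi> (a * \<bar>f x\<bar>)) \<partial>lebesgue)"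
  \<comment> \<open>The maximum with 1 keeps \<open>1 / k\<close> in the range where convexity
    through 0 applies.\<close>
  define k where "k = max 1 (enn2real I)"
  have k: "k \<ge> 1" "I \<le> ennreal k"
  proof -
    have "I = ennreal (enn2real I)" using a(2) by (simp add: I_def)
    also have "\<dots> \<le> ennreal k" unfolding k_def by (intro ennreal_leI) simp
    finally show "I \<le> ennreal k" .
  qed (simp add: k_def)
  have "(\<integral>\<^sup>+x. ennreal (\<Phi> ((1/k) * (a * \<bar>f x\<bar>))) \<partial>lebesgue) \<le> ennreal (1/k) * I"
    unfolding I_def using \<Phi> k a by (intro young_integral_scale) auto
  also have "\<dots> \<le> ennreal (1/k) * ennreal k" using k by (intro mult_left_mono) auto
  also have "\<dots> = 1" using k by (simp flip: ennreal_mult)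
  finally have "(\<integral>\<^sup>+x. ennreal (\<Phi> (\<bar>f x\<bar> / (k / a))) \<partial>lebesgue) \<le> 1"
    by (simp add: mult.commute)
  then have "orlicz_norm \<Phi> f \<le> ennreal (k / a)"
    unfolding orlicz_norm_def using k a by (intro INF_lower) auto
  then show ?thesis using le_less_trans by fastforce
qed

lemma orlicz_space_if_norm_finite:
  assumes "f \<in> borel_measurable lebesgue" and "orlicz_norm \<Phi> f < \<infinity>"
  shows "f \<in> orlicz_space \<Phi>"
proof -
  from assms(2) obtain b where b: "b > 0" "(\<integral>\<^sup>+x. ennreal (\<Phi> (\<bar>f x\<bar> / b)) \<partial>lebesgue) \<le> 1"
    unfolding orlicz_norm_def by (auto simp: INF_less_iff)
  then have "(\<integral>\<^sup>+x. ennreal (\<Phi> ((1 / b) * \<bar>f x\<bar>)) \<partial>lebesgue) < \<infinity>"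
    by (simp add: le_less_trans)
  then show ?thesis using b(1) assms(1) unfolding orlicz_space_def
    by (intro CollectI conjI exI[of _ "1 / b"]) auto
qed

section \<open>Hoelder's inequality from the pointwise inequality\<close>

text \<open>For admissible \<open>b i\<close>, the pointwise inequality at
  \<open>\<bar>f i x\<bar> / b i\<close> integrates to a modular of at most \<open>card I\<close>,
  since each summand contributes at most 1. Scaling by \<open>1 / card I\<close> then makes
  \<open>card I * C\<close> times the product of the \<open>b i\<close> admissible for the product
  function.\<close>

lemma orlicz_norm_prod_le:
  fixes f :: "'i \<Rightarrow> real ^ 'n \<Rightarrow> real"
  assumes "finite I" "I \<noteq> {}" and \<Phi>: "young_function \<Phi>"
    and \<Psi>: "\<And>i. i \<in> I \<Longrightarrow> young_function (\<Psi> i)" and "C > 0"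
    and le: "\<And>t. \<forall>i\<in>I. t i \<ge> 0 \<Longrightarrow> \<Phi> ((\<Prod>i\<in>I. t i) / C) \<le> (\<Sum>i\<in>I. \<Psi> i (t i))"
    and f: "\<And>i. i \<in> I \<Longrightarrow> f i \<in> orlicz_space (\<Psi> i)"
  shows "orlicz_norm \<Phi> (\<lambda>x. \<Prod>i\<in>I. f i x)
           \<le> ennreal (real (card I) * C) * (\<Prod>i\<in>I. orlicz_norm (\<Psi> i) (f i))"
proof -
  let ?m = "real (card I)"
  have m: "?m \<ge> 1" using assms(1,2) by (simp add: Suc_le_eq card_gt_0_iff)
  have meas: "f i \<in> borel_measurable lebesgue" if "i \<in> I" for i
    using f[OF that] by (simp add: orlicz_space_def)
  then have abs_meas: "(\<lambda>x. \<bar>f i x\<bar> / b) \<in> borel_measurable lebesgue" if "i \<in> I" for i b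
    using that by measurable
  have admissible: "orlicz_norm \<Phi> (\<lambda>x. \<Prod>i\<in>I. f i x) \<le> ennreal (?m * C * (\<Prod>i\<in>I. b i))"
    if b: "\<And>i. i \<in> I \<Longrightarrow> b i > 0 \<and> (\<integral>\<^sup>+x. ennreal (\<Psi> i (\<bar>f i x\<bar> / b i)) \<partial>lebesgue) \<le> 1" for b
  proof -
    define P where "P x = (\<Prod>i\<in>I. \<bar>f i x\<bar> / b i) / C" for x
    have P_nonneg: "0 \<le> P x" for x
      unfolding P_def using b \<open>C > 0\<close> by (intro divide_nonneg_pos prod_nonneg) (auto simp: less_imp_le)
    have P_meas: "P \<in> borel_measurable lebesgue"
      unfolding P_def using abs_meas by measurable
    have "(\<integral>\<^sup>+x. ennreal (\<Phi> (P x)) \<partial>lebesgue)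
        \<le> (\<integral>\<^sup>+x. (\<Sum>i\<in>I. ennreal (\<Psi> i (\<bar>f i x\<bar> / b i))) \<partial>lebesgue)"
    proof (rule nn_integral_mono)
      fix x
      have "\<Phi> (P x) \<le> (\<Sum>i\<in>I. \<Psi> i (\<bar>f i x\<bar> / b i))"
        unfolding P_def using b by (intro le) (auto simp: less_imp_le)
      moreover have "0 \<le> \<Psi> i (\<bar>f i x\<bar> / b i)" if "i \<in> I" for i
        using b[OF that] by (intro young_function_nonneg[OF \<Psi>[OF that]]) auto
      ultimately show "ennreal (\<Phi> (P x)) \<le> (\<Sum>i\<in>I. ennreal (\<Psi> i (\<bar>f i x\<bar> / b i)))"
        by (subst sum_ennreal) (simp_all add: ennreal_leI)
    qed
    also have "\<dots> = (\<Sum>i\<in>I. \<integral>\<^sup>+x. ennreal (\<Psi> i (\<bar>f i x\<bar> / b i)) \<partial>lebesgue)"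
    proof (intro nn_integral_sum measurable_compose[OF _ measurable_ennreal])
      fix i assume i: "i \<in> I"
      then show "(\<lambda>x. \<Psi> i (\<bar>f i x\<bar> / b i)) \<in> borel_measurable lebesgue"
        using b[OF i] by (intro young_function_measurable[OF \<Psi>[OF i] abs_meas[OF i]]) auto
    qed
    also have "\<dots> \<le> (\<Sum>i\<in>I. 1)" using b by (intro sum_mono) auto
    finally have int: "(\<integral>\<^sup>+x. ennreal (\<Phi> (P x)) \<partial>lebesgue) \<le> ennreal ?m"
      by (simp add: ennreal_of_nat_eq_real_of_nat)
    have "(\<integral>\<^sup>+x. ennreal (\<Phi> ((1 / ?m) * P x)) \<partial>lebesgue)
        \<le> ennreal (1 / ?m) * (\<integral>\<^sup>+x. ennreal (\<Phi> (P x)) \<partial>lebesgue)"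
      using m by (intro young_integral_scale \<Phi> P_meas P_nonneg) auto
    also have "\<dots> \<le> ennreal (1 / ?m) * ennreal ?m" by (intro mult_left_mono int) auto
    also have "\<dots> = 1" using m by (simp flip: ennreal_mult)
    finally have "(\<integral>\<^sup>+x. ennreal (\<Phi> (\<bar>\<Prod>i\<in>I. f i x\<bar> / (?m * C * (\<Prod>i\<in>I. b i)))) \<partial>lebesgue) \<le> 1"
      by (simp add: P_def prod_dividef abs_prod mult_ac)
    moreover have "?m * C * (\<Prod>i\<in>I. b i) > 0"
      using m \<open>C > 0\<close> b by (intro mult_pos_pos prod_pos) auto
    ultimately show ?thesis unfolding orlicz_norm_def by (intro INF_lower) auto
  qed
  define N where "N i = enn2real (orlicz_norm (\<Psi> i) (f i))" for i
  have N: "orlicz_norm (\<Psi> i) (f i) = ennreal (N i)" if "i \<in> I" for i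
    using orlicz_norm_finite[OF \<Psi>[OF that] f[OF that]] by (simp add: N_def)
  have N_nonneg: "0 \<le> N i" for i by (simp add: N_def)
  \<comment> \<open>The norms themselves need not be admissible, for instance when they are 0. Hence
    \<open>b i\<close> is chosen within e of the norm, and e tends to 0 afterwards.\<close>
  have approx: "orlicz_norm \<Phi> (\<lambda>x. \<Prod>i\<in>I. f i x) \<le> ennreal (?m * C * (\<Prod>i\<in>I. N i + e))"
    if "e > 0" for e
  proof -
    have "\<exists>b. b > 0 \<and> (\<integral>\<^sup>+x. ennreal (\<Psi> i (\<bar>f i x\<bar> / b)) \<partial>lebesgue) \<le> 1 \<and> b \<le> N i + e"
      if "i \<in> I" for i
    proof -
      have "orlicz_norm (\<Psi> i) (f i) < ennreal (N i + e)"
        using N[OF that] N_nonneg[of i] \<open>e > 0\<close> by (simp add: ennreal_less_iff)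
      then obtain b where "b > 0" "(\<integral>\<^sup>+x. ennreal (\<Psi> i (\<bar>f i x\<bar> / b)) \<partial>lebesgue) \<le> 1"
        "ennreal b < ennreal (N i + e)"
        unfolding orlicz_norm_def by (auto simp: INF_less_iff)
      then show ?thesis by (intro exI[of _ b]) (auto simp: ennreal_less_iff)
    qed
    then obtain b where b: "\<And>i. i \<in> I \<Longrightarrow> b i > 0 \<and>
        (\<integral>\<^sup>+x. ennreal (\<Psi> i (\<bar>f i x\<bar> / b i)) \<partial>lebesgue) \<le> 1 \<and> b i \<le> N i + e"
      by metis
    have "orlicz_norm \<Phi> (\<lambda>x. \<Prod>i\<in>I. f i x) \<le> ennreal (?m * C * (\<Prod>i\<in>I. b i))"
      using b by (intro admissible) auto
    also have "\<dots> \<le> ennreal (?m * C * (\<Prod>i\<in>I. N i + e))"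
      using b m \<open>C > 0\<close>
      by (intro ennreal_leI mult_left_mono prod_mono) (auto simp: less_imp_le)
    finally show ?thesis .
  qed
  have "((\<lambda>e. ennreal (?m * C * (\<Prod>i\<in>I. N i + e)))
      \<longlongrightarrow> ennreal (?m * C * (\<Prod>i\<in>I. N i + 0))) (at_right 0)"
    by (intro tendsto_intros)
  then have "orlicz_norm \<Phi> (\<lambda>x. \<Prod>i\<in>I. f i x) \<le> ennreal (?m * C * (\<Prod>i\<in>I. N i + 0))"
    by (rule tendsto_lowerbound)
      (use approx in \<open>auto simp: eventually_at_right_field intro!: exI[of _ 1]\<close>)
  also have "\<dots> = ennreal (?m * C) * (\<Prod>i\<in>I. orlicz_norm (\<Psi> i) (f i))"
    using m \<open>C > 0\<close> N N_nonneg by (simp add: ennreal_mult prod_nonneg prod_ennreal)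
  finally show ?thesis .
qed

section \<open>Step functions and the converse\<close>

text \<open>Boxes are lined up along one basis direction b: the k-th one spans the interval from
  \<open>S k\<close> to \<open>S (Suc k)\<close>, of length \<open>w k\<close>, along b and the unit
  interval in every other direction.\<close>

lemma disjoint_family_of_measures:
  fixes w :: "nat \<Rightarrow> real"
  assumes w: "\<And>k. w k > 0"
  obtains E :: "nat \<Rightarrow> 'a::euclidean_space set"
  where "disjoint_family E" "\<And>k. E k \<in> sets lebesgue" "\<And>k. emeasure lebesgue (E k) = ennreal (w k)"
proof -
  obtain b :: 'a where b: "b \<in> Basis" using nonempty_Basis by blast
  define S where "S k = (\<Sum>j<k. w j)" for k
  define l where "l k = S k *\<^sub>R b" for k
  \<comment> \<open>Subtracting 1 cancels the b-coordinate of \<open>One\<close>, so that this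
    coordinate becomes \<open>S (Suc k)\<close> and all others stay 1.\<close>
  define u where "u k = One + (S (Suc k) - 1) *\<^sub>R b" for k
  have lb: "l k \<bullet> i = (if i = b then S k else 0)" if "i \<in> Basis" for i k
    using that b by (simp add: l_def inner_Basis)
  have ub: "u k \<bullet> i = (if i = b then S (Suc k) else 1)" if "i \<in> Basis" for i k
    using that b by (simp add: u_def inner_Basis inner_add_left)
  have S: "S (Suc k) = S k + w k" for k by (simp add: S_def)
  have "mono S" using w by (intro monoI) (auto simp: S_def less_imp_le intro!: sum_mono2)
  have sub: "S k < x \<bullet> b \<and> x \<bullet> b < S (Suc k)" if "x \<in> box (l k) (u k)" for x k
    using that b by (auto simp: mem_box lb ub)
  have "box (l j) (u j) \<inter> box (l k) (u k) = {}" if "j < k" for j k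
  proof -
    have "S (Suc j) \<le> S k" using \<open>mono S\<close> that by (simp add: mono_def)
    then show ?thesis using sub[of _ j] sub[of _ k] by fastforce
  qed
  then have "disjoint_family (\<lambda>k. box (l k) (u k))"
    unfolding disjoint_family_on_def by (metis Int_commute nat_neq_iff)
  moreover have "emeasure lebesgue (box (l k) (u k)) = ennreal (w k)" for k
  proof -
    have "emeasure lborel (box (l k) (u k)) = ennreal (\<Prod>i\<in>Basis. (u k - l k) \<bullet> i)"
      using w[of k] by (subst emeasure_lborel_box) (auto simp: lb ub S)
    also have "(\<Prod>i\<in>Basis. (u k - l k) \<bullet> i) = (\<Prod>i\<in>Basis. if i = b then w k else 1)"
      by (intro prod.cong) (auto simp: inner_diff_left lb ub S)
    also have "\<dots> = w k" using b by simp
    finally show ?thesis by simp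
  qed
  ultimately show ?thesis by (intro that[of "\<lambda>k. box (l k) (u k)"]) auto
qed

text \<open>Only the k-th term can be nonzero at x. The type is kept general because the sum is
  needed both for real step functions and for their \<open>ennreal\<close> modulars.\<close>

lemma suminf_disjoint_indicator:
  fixes c :: "nat \<Rightarrow> 'b::{t2_space, topological_comm_monoid_add, semiring_1}"
  assumes "disjoint_family E" "x \<in> E k"
  shows "(\<Sum>j. c j * indicator (E j) x) = c k"
proof -
  have "x \<notin> E j" if "j \<noteq> k" for j
    using assms that by (auto simp: disjoint_family_on_def)
  then have "(\<Sum>j. c j * indicator (E j) x) = (\<Sum>j\<in>{k}. c j * indicator (E j) x)"
    by (intro suminf_finite) (auto simp: indicator_def)
  then show ?thesis using assms(2) by simp
qed

text \<open>
  If the pointwise inequality fails for every constant, choose points \<open>T k\<close> violating it with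
  constant \<open>8 ^ k\<close>. The step functions taking the values \<open>T k i\<close> on a set \<open>E k\<close> of measure
  \<open>(1/2) ^ k / v k\<close>, where \<open>v k\<close> is the left-hand side of the violated inequality, lie in the given
  Orlicz spaces, but the modular of any multiple of their product has contributions at least
  \<open>2 ^ k\<close> from all but finitely many \<open>E k\<close>.
\<close>

lemma pointwise_if_orlicz_prod:
  fixes \<Psi> :: "'i \<Rightarrow> real \<Rightarrow> real"
  assumes "finite I" "I \<noteq> {}" and \<Phi>: "young_function \<Phi>"
    and \<Psi>: "\<And>i. i \<in> I \<Longrightarrow> young_function (\<Psi> i)"
    and prod: "\<And>f :: 'i \<Rightarrow> real ^ 'n \<Rightarrow> real. (\<forall>i\<in>I. f i \<in> orlicz_space (\<Psi> i))
      \<Longrightarrow> (\<lambda>x. \<Prod>i\<in>I. f i x) \<in> orlicz_space \<Phi>"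
  shows "\<exists>C>0. \<forall>t. (\<forall>i\<in>I. t i \<ge> 0) \<longrightarrow> \<Phi> ((\<Prod>i\<in>I. t i) / C) \<le> (\<Sum>i\<in>I. \<Psi> i (t i))"
proof (rule ccontr)
  assume "\<not> ?thesis"
  then have "\<exists>t. (\<forall>i\<in>I. t i \<ge> 0) \<and> (\<Sum>i\<in>I. \<Psi> i (t i)) < \<Phi> ((\<Prod>i\<in>I. t i) / 8 ^ k)" for k :: nat
    by (auto simp: not_le dest!: spec[of _ "8 ^ k"])
  then obtain T where T_nonneg: "\<And>k i. i \<in> I \<Longrightarrow> T k i \<ge> 0"
    and T: "\<And>k::nat. (\<Sum>i\<in>I. \<Psi> i (T k i)) < \<Phi> ((\<Prod>i\<in>I. T k i) / 8 ^ k)"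
    using choice[of "\<lambda>k t. (\<forall>i\<in>I. t i \<ge> 0) \<and> (\<Sum>i\<in>I. \<Psi> i (t i)) < \<Phi> ((\<Prod>i\<in>I. t i) / 8 ^ k)"]
    by blast
  define v where "v k = \<Phi> ((\<Prod>i\<in>I. T k i) / 8 ^ k)" for k
  have \<Psi>_nonneg: "0 \<le> \<Psi> i (T k i)" if "i \<in> I" for k i
    by (rule young_function_nonneg[OF \<Psi>[OF that] T_nonneg[OF that]])
  have \<Psi>_less: "\<Psi> i (T k i) < v k" if "i \<in> I" for k i
    using member_le_sum[of i I "\<lambda>i. \<Psi> i (T k i)"] that \<Psi>_nonneg T[of k] \<open>finite I\<close>
    by (auto simp: v_def)
  \<comment> \<open>The violated inequality is strict and has a nonnegative smaller side, so
    dividing by \<open>v k\<close> gives a positive finite measure.\<close>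
  have v_pos: "v k > 0" for k
    using \<open>I \<noteq> {}\<close> \<Psi>_nonneg \<Psi>_less by (meson all_not_in_conv le_less_trans)
  obtain E :: "nat \<Rightarrow> (real ^ 'n) set" where E: "disjoint_family E"
    and E_sets[measurable]: "\<And>k. E k \<in> sets lebesgue"
    and E_meas: "\<And>k. emeasure lebesgue (E k) = ennreal ((1/2) ^ k / v k)"
    using disjoint_family_of_measures[of "\<lambda>k. (1/2) ^ k / v k"] v_pos
    by (metis divide_pos_pos half_gt_zero zero_less_one zero_less_power)
  define f where "f i x = (\<Sum>k. T k i * indicator (E k) x)" for i x
  have f_eq: "f i x = T k i" if "x \<in> E k" for i x k
    unfolding f_def by (rule suminf_disjoint_indicator[OF E that])
  have f_meas[measurable]: "f i \<in> borel_measurable lebesgue" for i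
    unfolding f_def by measurable
  have "f i \<in> orlicz_space (\<Psi> i)" if i: "i \<in> I" for i
  proof -
    have "ennreal (\<Psi> i (1 * \<bar>f i x\<bar>)) = (\<Sum>k. ennreal (\<Psi> i (T k i)) * indicator (E k) x)" for x
    proof (cases "\<exists>k. x \<in> E k")
      case True
      then obtain k where "x \<in> E k" by blast
      then show ?thesis
        using f_eq T_nonneg[OF i] by (simp add: suminf_disjoint_indicator[OF E])
    next
      case False
      then show ?thesis using \<Psi>[OF i] by (simp add: f_def young_function_def)
    qed
    then have "(\<integral>\<^sup>+x. ennreal (\<Psi> i (1 * \<bar>f i x\<bar>)) \<partial>lebesgue)
        = (\<integral>\<^sup>+x. (\<Sum>k. ennreal (\<Psi> i (T k i)) * indicator (E k) x) \<partial>lebesgue)"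
      by simp
    also have "\<dots> = (\<Sum>k. ennreal (\<Psi> i (T k i)) * emeasure lebesgue (E k))"
      by (subst nn_integral_suminf) (auto simp: nn_integral_cmult_indicator)
    \<comment> \<open>Since \<open>\<Psi> i (T k i) < v k\<close>, the factor \<open>1 / v k\<close>
      in the measure of \<open>E k\<close> leaves a geometric series.\<close>
    also have "\<dots> \<le> (\<Sum>k. ennreal ((1/2) ^ k))"
    proof (intro suminf_le)
      fix k
      have "\<Psi> i (T k i) * ((1/2) ^ k / v k) \<le> v k * ((1/2) ^ k / v k)"
        using \<Psi>_less[OF i, of k] v_pos[of k] by (intro mult_right_mono) auto
      also have "\<dots> = (1/2) ^ k" using v_pos[of k] by simp
      finally show "ennreal (\<Psi> i (T k i)) * emeasure lebesgue (E k) \<le> ennreal ((1/2) ^ k)"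
        using \<Psi>_nonneg[OF i] v_pos[of k] by (simp add: E_meas ennreal_leI flip: ennreal_mult)
    qed auto
    also have "\<dots> = ennreal (\<Sum>k. (1/2) ^ k)"
      by (intro suminf_ennreal2) auto
    also have "\<dots> < \<infinity>" by simp
    finally have "(\<integral>\<^sup>+x. ennreal (\<Psi> i (1 * \<bar>f i x\<bar>)) \<partial>lebesgue) < \<infinity>" .
    then show ?thesis using f_meas
      unfolding orlicz_space_def by (intro CollectI conjI exI[of _ 1]) auto
  qed
  then have "(\<lambda>x. \<Prod>i\<in>I. f i x) \<in> orlicz_space \<Phi>" by (intro prod) auto
  then obtain a where "a > 0"
    and fin: "(\<integral>\<^sup>+x. ennreal (\<Phi> (a * \<bar>\<Prod>i\<in>I. f i x\<bar>)) \<partial>lebesgue) < \<infinity>" (is "?J < _")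
    by (auto simp: orlicz_space_def)
  \<comment> \<open>The constant \<open>8 ^ k\<close> splits in two: a factor
    \<open>(1/2) ^ k\<close> is dominated by a, and the remaining \<open>(1/4) ^ k\<close> is pulled
    out of \<Phi> by convexity. So \<Phi> is at least \<open>4 ^ k * v k\<close> on
    \<open>E k\<close>, and the measure of \<open>E k\<close> turns this into
    \<open>2 ^ k\<close>.\<close>
  have lower: "ennreal (2 ^ k) \<le> ?J" if k: "(1/2) ^ k \<le> a" for k
  proof -
    let ?p = "\<Prod>i\<in>I. T k i"
    have p: "?p \<ge> 0" using T_nonneg by (intro prod_nonneg) auto
    have "(1/4) ^ k * (1/2) ^ k = (1/8 :: real) ^ k"
      by (subst power_mult_distrib[symmetric]) simp
    then have "v k = \<Phi> ((1/4) ^ k * ((1/2) ^ k * ?p))"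
      by (simp only: v_def mult.assoc[symmetric]) (simp add: power_one_over)
    also have "\<dots> \<le> (1/4) ^ k * \<Phi> ((1/2) ^ k * ?p)"
      using p by (intro young_function_scale[OF \<Phi>]) (auto simp: power_le_one)
    also have "\<dots> \<le> (1/4) ^ k * \<Phi> (a * ?p)"
      using p k by (intro mult_left_mono young_function_mono[OF \<Phi>] mult_right_mono) auto
    finally have "4 ^ k * v k \<le> \<Phi> (a * ?p)"
      by (simp add: field_simps power_divide)
    then have "4 ^ k * v k * ((1/2) ^ k / v k) \<le> \<Phi> (a * ?p) * ((1/2) ^ k / v k)"
      using v_pos[of k] by (intro mult_right_mono) auto
    moreover have "4 ^ k * v k * ((1/2) ^ k / v k) = 2 ^ k"
    proof -
      have "4 ^ k * v k * ((1/2) ^ k / v k) = 4 ^ k * (1/2) ^ k" using v_pos[of k] by simp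
      also have "\<dots> = 2 ^ k" by (subst power_mult_distrib[symmetric]) simp
      finally show ?thesis .
    qed
    ultimately have "ennreal (2 ^ k) \<le> ennreal (\<Phi> (a * ?p)) * emeasure lebesgue (E k)"
      using v_pos[of k] p \<open>a > 0\<close>
      by (simp add: E_meas ennreal_leI young_function_nonneg[OF \<Phi>] flip: ennreal_mult)
    also have "\<dots> = (\<integral>\<^sup>+x. ennreal (\<Phi> (a * ?p)) * indicator (E k) x \<partial>lebesgue)"
      by (simp add: nn_integral_cmult_indicator)
    also have "\<dots> \<le> ?J"
      using p f_eq[of _ k] by (intro nn_integral_mono) (auto simp: indicator_def)
    finally show ?thesis .
  qed
  have "((\<lambda>k. (1/2::real) ^ k) \<longlongrightarrow> 0) sequentially" by (intro LIMSEQ_power_zero) auto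
  then have "\<forall>\<^sub>F k in sequentially. (1/2) ^ k < a"
    using \<open>a > 0\<close> by (rule order_tendstoD)
  then obtain K where K: "\<And>k. k \<ge> K \<Longrightarrow> (1/2) ^ k \<le> a"
    unfolding eventually_sequentially using less_imp_le by blast
  obtain r where r: "?J = ennreal r" "0 \<le> r" using fin by (cases ?J) auto
  \<comment> \<open>The index \<open>max k K\<close> is large enough both to exceed the finite
    integral r and to satisfy the condition of \<open>lower\<close>.\<close>
  obtain k where "r < 2 ^ k" using real_arch_pow[of 2 r] by auto
  then have "r < 2 ^ max k K"
    by (rule less_le_trans) (intro power_increasing, auto)
  moreover have "2 ^ max k K \<le> r"
    using lower[OF K, of "max k K"] r by simp
  ultimately show False by simp
qed

section \<open>Equivalence of the four statements\<close>

theorem theorem2p1: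
  fixes m :: nat and \<Phi> :: "real \<Rightarrow> real" and \<Phi>s :: "nat \<Rightarrow> real \<Rightarrow> real"
  assumes "m \<ge> 2"
    and "young_function \<Phi>"
    and "\<And>i. i \<in> {1..m} \<Longrightarrow> young_function (\<Phi>s i)"
  shows
    "let
       S1 = (\<exists>C>0. \<forall>t\<ge>0. (\<Prod>i=1..m. young_inverse (\<Phi>s i) t) \<le> C * young_inverse \<Phi> t);
       S2 = (\<exists>C>0. \<forall>t :: nat \<Rightarrow> real. (\<forall>i\<in>{1..m}. t i \<ge> 0) \<longrightarrow>
               \<Phi> ((\<Prod>i=1..m. t i) / C) \<le> (\<Sum>i=1..m. \<Phi>s i (t i)));
       S3 = (\<exists>M::real. M > 0 \<and> (\<forall>f :: nat \<Rightarrow> real ^ 'n \<Rightarrow> real.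
               (\<forall>i\<in>{1..m}. f i \<in> orlicz_space (\<Phi>s i)) \<longrightarrow>
               orlicz_norm \<Phi> (\<lambda>x. \<Prod>i=1..m. f i x)
                 \<le> ennreal M * (\<Prod>i=1..m. orlicz_norm (\<Phi>s i) (f i))));
       S4 = (\<forall>f :: nat \<Rightarrow> real ^ 'n \<Rightarrow> real.
               (\<forall>i\<in>{1..m}. f i \<in> orlicz_space (\<Phi>s i)) \<longrightarrow>
               (\<lambda>x. \<Prod>i=1..m. f i x) \<in> orlicz_space \<Phi>)
     in (S1 \<longleftrightarrow> S2) \<and> (S2 \<longleftrightarrow> S3) \<and> (S3 \<longleftrightarrow> S4)"
    (is "let S1 = ?S1; S2 = ?S2; S3 = ?S3; S4 = ?S4 in _")
proof -
  note \<Phi> = assms(2) and \<Phi>s = assms(3)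
  have "?S2" if "?S1"
  proof -
    from that obtain C where C: "C > 0"
      and le: "\<And>t. t \<ge> 0 \<Longrightarrow> (\<Prod>i=1..m. young_inverse (\<Phi>s i) t) \<le> C * young_inverse \<Phi> t"
      by blast
    have "\<Phi> ((\<Prod>i=1..m. t i) / C) \<le> (\<Sum>i=1..m. \<Phi>s i (t i))"
      if t: "\<forall>i\<in>{1..m}. t i \<ge> 0" for t
    proof -
      \<comment> \<open>A common level for all factors: each \<open>\<Phi>s i (t i)\<close> is at
        most the whole sum, so every \<open>t i\<close> is bounded by an inverse at the same
        point.\<close>
      let ?s = "\<Sum>i=1..m. \<Phi>s i (t i)"
      have nonneg: "0 \<le> \<Phi>s i (t i)" if "i \<in> {1..m}" for i
        using t that by (intro young_function_nonneg[OF \<Phi>s]) auto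
      then have s: "0 \<le> ?s" by (rule sum_nonneg)
      have "t i \<le> young_inverse (\<Phi>s i) ?s" if "i \<in> {1..m}" for i
        using young_inverse_galois[OF \<Phi>s[OF that], of "t i" ?s] that t s
          member_le_sum[of i "{1..m}" "\<lambda>i. \<Phi>s i (t i)"] nonneg by auto
      then have "(\<Prod>i=1..m. t i) \<le> (\<Prod>i=1..m. young_inverse (\<Phi>s i) ?s)"
        using t by (intro prod_mono) auto
      also have "\<dots> \<le> C * young_inverse \<Phi> ?s" by (rule le[OF s])
      finally have "(\<Prod>i=1..m. t i) / C \<le> young_inverse \<Phi> ?s"
        using C by (simp add: divide_le_eq mult.commute)
      moreover have "0 \<le> (\<Prod>i=1..m. t i) / C"
        using t C by (intro divide_nonneg_pos prod_nonneg) auto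
      ultimately show ?thesis
        using young_inverse_galois[OF \<Phi> _ s] by blast
    qed
    with C show ?thesis by blast
  qed
  moreover have "?S1" if "?S2"
  proof -
    from that obtain C where C: "C > 0" and le: "\<And>t. \<forall>i\<in>{1..m}. t i \<ge> 0
        \<Longrightarrow> \<Phi> ((\<Prod>i=1..m. t i) / C) \<le> (\<Sum>i=1..m. \<Phi>s i (t i))"
      by blast
    have "(\<Prod>i=1..m. young_inverse (\<Phi>s i) t) \<le> real m * C * young_inverse \<Phi> t" if t: "t \<ge> 0" for t
    proof -
      let ?p = "\<Prod>i=1..m. young_inverse (\<Phi>s i) t"
      have nonneg: "0 \<le> young_inverse (\<Phi>s i) t" if "i \<in> {1..m}" for i
        by (rule young_inverse_nonneg[OF \<Phi>s[OF that] t])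
      then have p: "?p \<ge> 0" by (rule prod_nonneg)
      \<comment> \<open>At the inverses, each of the m summands in (2) is at most t. The factor
        \<open>1 / real m\<close> compensates for their number and is the source of the constant
        \<open>real m * C\<close>.\<close>
      have "\<Phi> ((1 / real m) * (?p / C)) \<le> (1 / real m) * \<Phi> (?p / C)"
        using p C assms(1) by (intro young_function_scale[OF \<Phi>]) auto
      also have "\<dots> \<le> (1 / real m) * (\<Sum>i=1..m. \<Phi>s i (young_inverse (\<Phi>s i) t))"
        using nonneg by (intro mult_left_mono le) auto
      also have "\<dots> \<le> (1 / real m) * (\<Sum>i=1..m. t)"
        using young_inverse_galois[OF \<Phi>s nonneg t] by (intro mult_left_mono sum_mono) auto
      also have "\<dots> = t" using assms(1) by simp
      finally have "(1 / real m) * (?p / C) \<le> young_inverse \<Phi> t"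
        using young_inverse_galois[OF \<Phi> _ t] p C by simp
      then show ?thesis using C assms(1) by (simp add: field_simps)
    qed
    moreover have "real m * C > 0" using C assms(1) by simp
    ultimately show ?thesis by blast
  qed
  moreover have "?S3" if "?S2"
  proof -
    from that obtain C where C: "C > 0" and le: "\<And>t. \<forall>i\<in>{1..m}. t i \<ge> 0
        \<Longrightarrow> \<Phi> ((\<Prod>i=1..m. t i) / C) \<le> (\<Sum>i=1..m. \<Phi>s i (t i))"
      by blast
    have "orlicz_norm \<Phi> (\<lambda>x. \<Prod>i=1..m. f i x)
        \<le> ennreal (real m * C) * (\<Prod>i=1..m. orlicz_norm (\<Phi>s i) (f i))"
      if "\<forall>i\<in>{1..m}. f i \<in> orlicz_space (\<Phi>s i)" for f :: "nat \<Rightarrow> real ^ 'n \<Rightarrow> real"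
      using orlicz_norm_prod_le[of "{1..m}" \<Phi> \<Phi>s C f, OF _ _ \<Phi> \<Phi>s C le] that assms(1) by simp
    moreover have "real m * C > 0" using C assms(1) by simp
    ultimately show ?thesis by blast
  qed
  moreover have "?S4" if "?S3"
  proof (intro allI impI)
    fix f :: "nat \<Rightarrow> real ^ 'n \<Rightarrow> real"
    assume f: "\<forall>i\<in>{1..m}. f i \<in> orlicz_space (\<Phi>s i)"
    from that f obtain M where "orlicz_norm \<Phi> (\<lambda>x. \<Prod>i=1..m. f i x)
        \<le> ennreal M * (\<Prod>i=1..m. orlicz_norm (\<Phi>s i) (f i))"
      by blast
    also have "\<dots> < \<infinity>"
    proof -
      \<comment> \<open>Finiteness of every factor makes the right-hand side of (3) finite, and a
        finite norm is what puts the product into the Orlicz space.\<close>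
      have "orlicz_norm (\<Phi>s i) (f i) \<noteq> \<infinity>" if "i \<in> {1..m}" for i
        using orlicz_norm_finite[OF \<Phi>s[OF that], of "f i"] f that by simp
      then have "(\<Prod>i=1..m. orlicz_norm (\<Phi>s i) (f i)) \<noteq> \<infinity>"
        by (simp add: ennreal_prod_eq_top)
      then show ?thesis by (simp add: ennreal_mult_eq_top_iff less_top[symmetric])
    qed
    finally show "(\<lambda>x. \<Prod>i=1..m. f i x) \<in> orlicz_space \<Phi>"
      using f by (intro orlicz_space_if_norm_finite borel_measurable_prod)
        (auto simp: orlicz_space_def)
  qed
  moreover have "?S2" if "?S4"
    using that assms(1) by (intro pointwise_if_orlicz_prod[OF _ _ \<Phi> \<Phi>s]) auto
  ultimately show ?thesis unfolding Let_def by blast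
qed

end
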